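(* Let $G$ be a finite nilpotent group. Then the co-prime graph $\Gamma(G)$ is a cograph if and only if $|\pi(G)|<3$.
   Context: For a finite group $G$, the co-prime graph $\Gamma(G)$ is the simple undirected graph with vertex set $G$ (including the identity) in which two distinct vertices $x,y$ are adjacent if and only if $\gcd(o(x),o(y))=1$, where $o(g)$ denotes the order of $g$. $\pi(G)$ denotes the set of prime divisors of $|G|$. A graph is a cograph if it contains no induced subgraph isomorphic to $P_4$, the path on 4 vertices. *)

theory Defs
  imports
    "HOL-Algebra.Generated_Groups"
    "HOL-Algebra.Multiplicative_Group"
    "HOL-Computational_Algebra.Primes"
    "Graph_Theory.Graph_Theory"
begin

primrec lower_central_series :: "('a, 'b) monoid_scheme \<Rightarrow> nat \<Rightarrow> 'a set" where
  "lower_central_series G 0 = carrier G"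
| "lower_central_series G (Suc n) =
    generate G (\<Union>h \<in> lower_central_series G n. \<Union>g \<in> carrier G.
      {h \<otimes>\<^bsub>G\<^esub> g \<otimes>\<^bsub>G\<^esub> inv\<^bsub>G\<^esub> h \<otimes>\<^bsub>G\<^esub> inv\<^bsub>G\<^esub> g})"

definition nilpotent_group :: "('a, 'b) monoid_scheme \<Rightarrow> bool" where
  "nilpotent_group G \<longleftrightarrow> group G \<and> (\<exists>n. lower_central_series G n = {\<one>\<^bsub>G\<^esub>})"

text \<open>
  As in the library, a simple undirected graph is a symmetric loop-free digraph without parallel
  arcs (locale \<^locale>\<open>pair_graph\<close>): an edge between two vertices is a pair of opposite arcs.
\<close>

definition coprime_graph :: "('a, 'b) monoid_scheme \<Rightarrow> 'a pair_pre_digraph" where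
  "coprime_graph G = \<lparr> pverts = carrier G,
     parcs = {(x, y). x \<in> carrier G \<and> y \<in> carrier G \<and> x \<noteq> y \<and>
                      gcd (group.ord G x) (group.ord G y) = 1} \<rparr>"

definition path_graph :: "nat \<Rightarrow> nat pair_pre_digraph" where
  "path_graph n = \<lparr> pverts = {..<n},
     parcs = {(i, j). i < n \<and> j < n \<and> (j = Suc i \<or> i = Suc j)} \<rparr>"

text \<open>
  \<^const>\<open>induced_subgraph\<close> requires its arguments to be well-formed digraphs, so the following
  is meaningful for graphs only; the two lemmas below show that this is the case where it is used.
\<close>

definition cograph :: "('a, 'b) pre_digraph \<Rightarrow> bool" where
  "cograph G \<longleftrightarrow> \<not> (\<exists>H. induced_subgraph H G \<and> digraph_iso H (with_proj (path_graph 4)))"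

lemma pair_graph_coprime_graph:
  assumes "finite (carrier G)"
  shows "pair_graph (coprime_graph G)"
proof -
  have "parcs (coprime_graph G) \<subseteq> carrier G \<times> carrier G"
    by (auto simp: coprime_graph_def)
  with assms have "finite (parcs (coprime_graph G))"
    by (meson finite_SigmaI finite_subset)
  with assms show ?thesis
    by unfold_locales
      (auto simp: coprime_graph_def symmetric_def gcd.commute intro!: symI)
qed

lemma pair_graph_path_graph: "pair_graph (path_graph n)"
proof -
  have "parcs (path_graph n) \<subseteq> {..<n} \<times> {..<n}"
    by (auto simp: path_graph_def)
  then have "finite (parcs (path_graph n))"
    by (meson finite_SigmaI finite_lessThan finite_subset)
  then show ?thesis
    by unfold_locales (auto simp: path_graph_def symmetric_def intro!: symI)
qed

end

theory Submission
  imports Defs "HOL-Algebra.Sylow"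
begin

text \<open>
  An induced path on four vertices in the co-prime graph is a sequence $a, b, c, d$ of elements in
  which the orders of neighbours are coprime and the orders of the pairs $a,c$ and $b,d$ and $a,d$
  share a prime. The three shared primes are distinct: any two of these
  pairs contain adjacent elements, whose coprime orders cannot have a prime in common. Hence every
  finite group whose co-prime graph has an induced path has at least three prime divisors
  (\<open>three_primes_of_coprime_path\<close>).

  Conversely, the path arises from three primes $p, q, r$ as soon as there are elements of orders
  $qr$, $p$, $q$, $pr$, in this order. Cauchy's theorem gives elements of prime order, and in a
  nilpotent group elements of coprime order commute (\<open>nilpotent_group_coprime_commute\<close>), so that
  the products of elements of prime order have the required orders.

  That coprime elements commute is proved without the decomposition into Sylow subgroups. If the
  commutator $c = [x, y]$ lies in a term of the lower central series, then $c$ is central modulo the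
  next term. There $[x^k, y] = c^k$ and likewise for powers of $y$, so the order of $c$ modulo the
  next term divides the orders of $x$ and of $y$; it is 1, and $c$ lies in the next term.
  By induction $c$ lies in all terms, one of which is trivial.
\<close>

section \<open>Induced paths in simple graphs\<close>

text \<open>
  This replaces a sub-digraph together with a record of maps on vertices and arcs by a single
  embedding of vertices. The arc maps carry no information: in a graph whose arcs are pairs, an arc
  is determined by its ends.
\<close>

lemma ex_induced_subgraph_iso_iff:
  fixes D :: "'a pair_pre_digraph" and E :: "'b pair_pre_digraph"
  assumes D: "pair_wf_digraph D" and E: "pair_wf_digraph E"
  shows "(\<exists>H. induced_subgraph H (with_proj D) \<and> digraph_iso H (with_proj E)) \<longleftrightarrow>
         (\<exists>g. inj_on g (pverts E) \<and> g ` pverts E \<subseteq> pverts D \<and>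
              (\<forall>i\<in>pverts E. \<forall>j\<in>pverts E. (g i, g j) \<in> parcs D \<longleftrightarrow> (i, j) \<in> parcs E))"
    (is "?L \<longleftrightarrow> ?R")
proof
  assume ?L
  then obtain H f where ind: "induced_subgraph H (with_proj D)"
    and f: "pre_digraph.digraph_isomorphism H f" and eq: "with_proj E = app_iso f H"
    by (auto simp: digraph_iso_def)
  have th: "tail H = fst" "head H = snd" and HV: "verts H \<subseteq> pverts D"
    and HA: "arcs H = {e \<in> parcs D. fst e \<in> verts H \<and> snd e \<in> verts H}"
    using ind by (auto simp: induced_subgraph_def subgraph_def compatible_def)
  let ?v = "iso_verts f"
  have inj: "inj_on ?v (verts H)"
    and arc: "\<And>e. e \<in> arcs H \<Longrightarrow>
      ?v (fst e) = iso_tail f (iso_arcs f e) \<and> ?v (snd e) = iso_head f (iso_arcs f e)"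
    using f by (auto simp: pre_digraph.digraph_isomorphism_def th)
  have EV: "pverts E = ?v ` verts H" and EA: "parcs E = iso_arcs f ` arcs H"
    and ft: "iso_tail f = fst" and fh: "iso_head f = snd"
    using arg_cong[OF eq, of verts] arg_cong[OF eq, of arcs]
      arg_cong[OF eq, of tail] arg_cong[OF eq, of head] by auto
  have arc': "iso_arcs f e = (?v (fst e), ?v (snd e))" if "e \<in> arcs H" for e
    using arc[OF that] by (simp add: ft fh)
  (* The embedding of E into D is the inverse of the isomorphism from H onto E. *)
  let ?g = "the_inv_into (verts H) ?v"
  have g: "?g i \<in> verts H" "?v (?g i) = i" if "i \<in> pverts E" for i
    using that inj by (auto simp: EV the_inv_into_f_f)
  show ?R
  proof (intro exI conjI ballI)
    show "inj_on ?g (pverts E)"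
      by (metis g(2) inj_onI)
    show "?g ` pverts E \<subseteq> pverts D"
      using g(1) HV by blast
  next
    fix i j assume ij: "i \<in> pverts E" "j \<in> pverts E"
    show "(?g i, ?g j) \<in> parcs D \<longleftrightarrow> (i, j) \<in> parcs E"
    proof
      assume "(?g i, ?g j) \<in> parcs D"
      then have "(?g i, ?g j) \<in> arcs H"
        using g(1) ij by (simp add: HA)
      then show "(i, j) \<in> parcs E"
        using arc' g(2) ij by (force simp: EA)
    next
      assume "(i, j) \<in> parcs E"
      then obtain e where e: "e \<in> arcs H" "(i, j) = iso_arcs f e"
        by (auto simp: EA)
      with arc' have "i = ?v (fst e)" "j = ?v (snd e)"
        by auto
      moreover have "fst e \<in> verts H" "snd e \<in> verts H" "e \<in> parcs D"
        using e(1) by (auto simp: HA)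
      ultimately show "(?g i, ?g j) \<in> parcs D"
        using inj by (simp add: the_inv_into_f_f)
    qed
  qed
next
  assume ?R
  then obtain g where inj: "inj_on g (pverts E)" and sub: "g ` pverts E \<subseteq> pverts D"
    and adj: "\<And>i j. i \<in> pverts E \<Longrightarrow> j \<in> pverts E \<Longrightarrow>
      (g i, g j) \<in> parcs D \<longleftrightarrow> (i, j) \<in> parcs E"
    by blast
  interpret D: pair_wf_digraph D by (rule D)
  interpret E: pair_wf_digraph E by (rule E)
  let ?H = "with_proj D \<restriction> (g ` pverts E)"
  let ?v = "the_inv_into (pverts E) g"
  let ?f = "\<lparr>iso_verts = ?v, iso_arcs = map_prod ?v ?v, iso_head = snd, iso_tail = fst\<rparr>"
  have v: "?v (g i) = i" if "i \<in> pverts E" for i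
    using that inj by (simp add: the_inv_into_f_f)
  have arcs_H: "arcs ?H = map_prod g g ` parcs E"
  proof (intro equalityI subsetI)
    fix e assume "e \<in> arcs ?H"
    then obtain i j where "e = (g i, g j)" "i \<in> pverts E" "j \<in> pverts E" "e \<in> parcs D"
      by (cases e) (auto simp: induce_subgraph_def)
    then show "e \<in> map_prod g g ` parcs E"
      using adj by force
  next
    fix e assume "e \<in> map_prod g g ` parcs E"
    then obtain i j where "e = (g i, g j)" "(i, j) \<in> parcs E"
      by auto
    moreover from this have "i \<in> pverts E" "j \<in> pverts E"
      using E.arc_fst_in_verts E.arc_snd_in_verts by force+
    ultimately show "e \<in> arcs ?H"
      using adj by (auto simp: induce_subgraph_def)
  qed
  have v_arcs: "map_prod ?v ?v (map_prod g g e) = e" if "e \<in> parcs E" for e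
    using that v E.arc_fst_in_verts E.arc_snd_in_verts by (cases e) force
  have "induced_subgraph ?H (with_proj D)"
    using sub by (rule D.induced_induce)
  moreover have "digraph_iso ?H (with_proj E)"
    unfolding digraph_iso_def
  proof (intro exI conjI)
    show "pre_digraph.digraph_isomorphism ?H ?f"
      unfolding pre_digraph.digraph_isomorphism_def
    proof (intro conjI)
      show "wf_digraph ?H"
        by (rule D.wellformed_induce_subgraph)
      show "inj_on (iso_verts ?f) (verts ?H)"
        using v by (auto intro: inj_onI)
      show "inj_on (iso_arcs ?f) (arcs ?H)"
        unfolding arcs_H
        by (rule inj_on_inverseI[where g = "map_prod g g"])
          (elim imageE, simp add: v_arcs del: map_prod_simp)
    qed (auto simp: induce_subgraph_def)
    have "?v ` g ` pverts E = pverts E"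
      using v by (force simp: image_image)
    moreover have "map_prod ?v ?v ` map_prod g g ` parcs E = parcs E"
      using v_arcs by (force simp: image_image)
    ultimately show "with_proj E = app_iso ?f ?H"
      unfolding app_iso_def arcs_H by (simp add: with_proj_def)
  qed
  ultimately show ?L by blast
qed

lemma cograph_iff:
  assumes "pair_graph D"
  shows "cograph (with_proj D) \<longleftrightarrow>
    \<not> (\<exists>a\<in>pverts D. \<exists>b\<in>pverts D. \<exists>c\<in>pverts D. \<exists>d\<in>pverts D. distinct [a, b, c, d] \<and>
         (a, b) \<in> parcs D \<and> (b, c) \<in> parcs D \<and> (c, d) \<in> parcs D \<and>
         (a, c) \<notin> parcs D \<and> (b, d) \<notin> parcs D \<and> (a, d) \<notin> parcs D)"
proof -
  interpret D: pair_graph D by (rule assms)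
  have sym: "(x, y) \<in> parcs D \<longleftrightarrow> (y, x) \<in> parcs D" for x y
    using D.sym_arcs by (auto simp: symmetric_def dest: symD)
  have loop: "(x, x) \<notin> parcs D" for x
    using D.no_loops by fastforce
  interpret P: pair_graph "path_graph 4" by (rule pair_graph_path_graph)
  have V: "pverts (path_graph 4) = {0, 1, 2, 3}"
    by (auto simp: path_graph_def)
  have A: "(i, j) \<in> parcs (path_graph 4) \<longleftrightarrow> i < 4 \<and> j < 4 \<and> (j = Suc i \<or> i = Suc j)" for i j
    by (simp add: path_graph_def)
  show ?thesis
    unfolding cograph_def
      ex_induced_subgraph_iso_iff[OF D.pair_wf_digraph_axioms P.pair_wf_digraph_axioms]
  proof (intro arg_cong[where f = Not] iffI; elim exE bexE conjE)
    fix g :: "nat \<Rightarrow> 'a"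
    assume inj: "inj_on g (pverts (path_graph 4))" and sub: "g ` pverts (path_graph 4) \<subseteq> pverts D"
      and adj: "\<forall>i\<in>pverts (path_graph 4). \<forall>j\<in>pverts (path_graph 4).
        (g i, g j) \<in> parcs D \<longleftrightarrow> (i, j) \<in> parcs (path_graph 4)"
    have "g 0 \<in> pverts D" "g 1 \<in> pverts D" "g 2 \<in> pverts D" "g 3 \<in> pverts D"
      using sub by (auto simp: V)
    moreover have "distinct [g 0, g 1, g 2, g 3]"
      using inj by (simp add: V)
    moreover have "(g 0, g 1) \<in> parcs D \<and> (g 1, g 2) \<in> parcs D \<and> (g 2, g 3) \<in> parcs D \<and>
      (g 0, g 2) \<notin> parcs D \<and> (g 1, g 3) \<notin> parcs D \<and> (g 0, g 3) \<notin> parcs D"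
      using adj by (simp add: V A)
    ultimately show "\<exists>a\<in>pverts D. \<exists>b\<in>pverts D. \<exists>c\<in>pverts D. \<exists>d\<in>pverts D. distinct [a, b, c, d] \<and>
         (a, b) \<in> parcs D \<and> (b, c) \<in> parcs D \<and> (c, d) \<in> parcs D \<and>
         (a, c) \<notin> parcs D \<and> (b, d) \<notin> parcs D \<and> (a, d) \<notin> parcs D"
      by blast
  next
    fix a b c d
    assume "a \<in> pverts D" "b \<in> pverts D" "c \<in> pverts D" "d \<in> pverts D" "distinct [a, b, c, d]"
         "(a, b) \<in> parcs D" "(b, c) \<in> parcs D" "(c, d) \<in> parcs D"
         "(a, c) \<notin> parcs D" "(b, d) \<notin> parcs D" "(a, d) \<notin> parcs D"
    then show "\<exists>g. inj_on g (pverts (path_graph 4)) \<and> g ` pverts (path_graph 4) \<subseteq> pverts D \<and>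
      (\<forall>i\<in>pverts (path_graph 4). \<forall>j\<in>pverts (path_graph 4).
        (g i, g j) \<in> parcs D \<longleftrightarrow> (i, j) \<in> parcs (path_graph 4))"
      using sym loop
      by (intro exI[of _ "\<lambda>i. [a, b, c, d] ! i"]) (simp add: V A)
  qed
qed

section \<open>Commutators and the lower central series\<close>

context group
begin

lemma inv_mult_cancel_left:
  "x \<in> carrier G \<Longrightarrow> y \<in> carrier G \<Longrightarrow> inv x \<otimes> (x \<otimes> y) = y"
  by (simp flip: m_assoc)

lemma commutator_swap:
  assumes "x \<in> carrier G" "y \<in> carrier G"
  shows "x \<otimes> y = x \<otimes> y \<otimes> inv x \<otimes> inv y \<otimes> (y \<otimes> x)"
  using assms by (simp add: m_assoc inv_mult_cancel_left)

text \<open>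
  The factor \<open>c\<close> is the commutator of \<open>x\<close> and \<open>y\<close>: moving \<open>y\<close> to the left past one factor \<open>x\<close>
  produces one \<open>c\<close>, which commutes with the remaining factors. So $[x^n, y] = [x, y]^n$.
\<close>

lemma pow_mult_twisted:
  fixes n :: nat
  assumes [simp]: "x \<in> carrier G" "y \<in> carrier G" "c \<in> carrier G"
    and xy: "x \<otimes> y = c \<otimes> (y \<otimes> x)" and cx: "c \<otimes> x = x \<otimes> c"
  shows "x [^] n \<otimes> y = c [^] n \<otimes> (y \<otimes> x [^] n)"
proof (induction n)
  case (Suc n)
  have cxn: "x [^] n \<otimes> c = c \<otimes> x [^] n"
    using cx by (simp add: nat_pow_comm group_commutes_pow)
  have "x [^] Suc n \<otimes> y = x [^] n \<otimes> (c \<otimes> (y \<otimes> x))"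
    by (simp add: m_assoc xy)
  also have "\<dots> = c \<otimes> (x [^] n \<otimes> y) \<otimes> x"
    by (simp add: m_assoc[symmetric] cxn)
  also have "\<dots> = c \<otimes> c [^] n \<otimes> (y \<otimes> x [^] Suc n)"
    by (simp add: Suc.IH m_assoc)
  also have "c \<otimes> c [^] n = c [^] Suc n"
    by (metis assms(3) nat_pow_Suc2)
  finally show ?case .
qed simp

lemma central_commutator_pow_eq_one:
  fixes n :: nat
  assumes [simp]: "x \<in> carrier G" "y \<in> carrier G" "c \<in> carrier G"
    and "x \<otimes> y = c \<otimes> (y \<otimes> x)" "c \<otimes> x = x \<otimes> c" "x [^] n = \<one>"
  shows "c [^] n = \<one>"
  using pow_mult_twisted[OF assms(1-5), of n] assms(6)
  by (metis assms(2,3) nat_pow_closed l_one r_cancel_one' r_one)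

text \<open>
  The exponents \<open>m\<close> and \<open>n\<close> are arbitrary annihilating exponents rather than the orders themselves,
  so that the lemma applies in a quotient with the exponents taken from the original group.
\<close>

lemma central_commutator_eq_one:
  fixes m n :: nat
  assumes x: "x \<in> carrier G" and y: "y \<in> carrier G" and c: "c \<in> carrier G"
    and xy: "x \<otimes> y = c \<otimes> (y \<otimes> x)" and cx: "c \<otimes> x = x \<otimes> c" and cy: "c \<otimes> y = y \<otimes> c"
    and xm: "x [^] m = \<one>" and yn: "y [^] n = \<one>" and "coprime m n"
  shows "c = \<one>"
proof -
  have "ord c dvd m"
    using central_commutator_pow_eq_one[OF x y c xy cx xm] c by (simp add: pow_eq_id)
  (* Exchanging x and y inverts the commutator, and c and its inverse have the same order. *)
  moreover have "ord c dvd n"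
  proof -
    have yx: "y \<otimes> x = inv c \<otimes> (x \<otimes> y)"
      using x y c by (metis xy inv_solve_left m_closed)
    have cy': "inv c \<otimes> y = y \<otimes> inv c"
      using y c cy by (metis inv_closed inv_solve_left inv_solve_right m_assoc m_closed)
    have "inv c [^] n = \<one>"
      using central_commutator_pow_eq_one[OF y x inv_closed[OF c] yx cy' yn] .
    then show ?thesis
      using c pow_eq_id[of "inv c" n] by simp
  qed
  ultimately have "ord c = 1"
    using \<open>coprime m n\<close> by (metis coprime_common_divisor nat_dvd_1_iff_1)
  then show ?thesis
    using c ord_eq_1 by blast
qed

text \<open>
  Conjugation maps the commutator of \<open>h\<close> and \<open>g\<close> to the commutator of their conjugates, so the
  generating set of the next term is closed under conjugation if the current term is.
\<close>

lemma lower_central_series_normal: "lower_central_series G n \<lhd> G"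
proof (induction n)
  case 0
  show ?case
    by (auto intro!: normal_invI simp: subgroup_self)
next
  case (Suc n)
  let ?L = "lower_central_series G n"
  have L: "h \<in> carrier G" if "h \<in> ?L" for h
    using that Suc normal_imp_subgroup subgroup.subset by blast
  show ?case
    unfolding lower_central_series.simps
  proof (rule normal_generateI)
    show "(\<Union>h\<in>?L. \<Union>g\<in>carrier G. {h \<otimes> g \<otimes> inv h \<otimes> inv g}) \<subseteq> carrier G"
      using L by auto
  next
    fix u k assume "u \<in> (\<Union>h\<in>?L. \<Union>g\<in>carrier G. {h \<otimes> g \<otimes> inv h \<otimes> inv g})" and k: "k \<in> carrier G"
    then obtain h g where h: "h \<in> ?L" and g: "g \<in> carrier G"
      and u: "u = h \<otimes> g \<otimes> inv h \<otimes> inv g"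
      by blast
    have hG: "h \<in> carrier G"
      using h L by blast
    let ?h = "k \<otimes> h \<otimes> inv k" and ?g = "k \<otimes> g \<otimes> inv k"
    have "k \<otimes> u \<otimes> inv k = ?h \<otimes> ?g \<otimes> inv ?h \<otimes> inv ?g"
      using k hG g by (simp add: u m_assoc inv_mult_group inv_mult_cancel_left)
    moreover have "?h \<in> ?L"
      using Suc k h by (simp add: normal_invE(2))
    ultimately show "k \<otimes> u \<otimes> inv k \<in> (\<Union>h\<in>?L. \<Union>g\<in>carrier G. {h \<otimes> g \<otimes> inv h \<otimes> inv g})"
      using k g by blast
  qed
qed

lemma commutator_mem_lower_central_series:
  assumes "h \<in> lower_central_series G n" "g \<in> carrier G"
  shows "h \<otimes> g \<otimes> inv h \<otimes> inv g \<in> lower_central_series G (Suc n)"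
  using assms by (auto intro!: generate.incl)

text \<open>
  The induction step works in the quotient by the next term of the series: consecutive terms have a
  central quotient, so there the commutator commutes with everything and
  \<open>central_commutator_eq_one\<close> applies.
\<close>

lemma commutator_coprime_mem_lower_central_series:
  assumes x: "x \<in> carrier G" and y: "y \<in> carrier G" and cop: "coprime (ord x) (ord y)"
  shows "x \<otimes> y \<otimes> inv x \<otimes> inv y \<in> lower_central_series G n"
proof (induction n)
  case 0
  show ?case using x y by simp
next
  case (Suc n)
  define c where "c = x \<otimes> y \<otimes> inv x \<otimes> inv y"
  have c: "c \<in> carrier G"
    using x y by (simp add: c_def)
  define N where "N = lower_central_series G (Suc n)"
  interpret N: normal N G
    unfolding N_def by (rule lower_central_series_normal)
  interpret Q: group "G Mod N"
    by (rule N.factorgroup_is_group)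
  interpret \<phi>: group_hom G "G Mod N" "\<lambda>a. N #> a"
    by unfold_locales (rule N.r_coset_hom_Mod)
  let ?Q = "G Mod N"
  have central: "(N #> c) \<otimes>\<^bsub>?Q\<^esub> (N #> g) = (N #> g) \<otimes>\<^bsub>?Q\<^esub> (N #> c)" if g: "g \<in> carrier G" for g
  proof -
    let ?u = "c \<otimes> g \<otimes> inv c \<otimes> inv g"
    have u: "?u \<in> carrier G" using c g by simp
    have "?u \<in> N"
      using Suc g unfolding N_def c_def by (rule commutator_mem_lower_central_series)
    then have "N #> ?u = N"
      using u N.is_subgroup by (intro coset_join2)
    moreover have "c \<otimes> g = ?u \<otimes> (g \<otimes> c)"
      using c g by (rule commutator_swap)
    ultimately have "N #> (c \<otimes> g) = N #> (g \<otimes> c)"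
      using c g u by (metis coset_mult_assoc m_closed N.subset)
    then show ?thesis
      using c g by (metis \<phi>.hom_mult m_closed)
  qed
  have "N #> c = \<one>\<^bsub>?Q\<^esub>"
  proof (rule Q.central_commutator_eq_one)
    show "(N #> x) \<otimes>\<^bsub>?Q\<^esub> (N #> y) = (N #> c) \<otimes>\<^bsub>?Q\<^esub> ((N #> y) \<otimes>\<^bsub>?Q\<^esub> (N #> x))"
    proof -
      have "x \<otimes> y = c \<otimes> (y \<otimes> x)"
        unfolding c_def using x y by (rule commutator_swap)
      then show ?thesis
        using x y c by (metis \<phi>.hom_mult m_closed)
    qed
    show "(N #> x) [^]\<^bsub>?Q\<^esub> ord x = \<one>\<^bsub>?Q\<^esub>" "(N #> y) [^]\<^bsub>?Q\<^esub> ord y = \<one>\<^bsub>?Q\<^esub>"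
      using x y by (simp_all flip: \<phi>.hom_nat_pow)
  qed (use x y c central cop in auto)
  then show ?case
    using c coset_join1[OF _ c N.is_subgroup] by (simp add: FactGroup_def c_def N_def)
qed

end

lemma nilpotent_group_coprime_commute:
  fixes G (structure)
  assumes "nilpotent_group G" and x: "x \<in> carrier G" and y: "y \<in> carrier G"
    and "coprime (group.ord G x) (group.ord G y)"
  shows "x \<otimes> y = y \<otimes> x"
proof -
  interpret group G using assms(1) by (simp add: nilpotent_group_def)
  obtain n where "lower_central_series G n = {\<one>}"
    using assms(1) by (auto simp: nilpotent_group_def)
  then have "x \<otimes> y \<otimes> inv x \<otimes> inv y = \<one>"
    using commutator_coprime_mem_lower_central_series[OF x y assms(4), of n] by simp
  then show ?thesis
    using x y by (metis inv_closed inv_equality inv_inv inv_mult_group m_assoc m_closed)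
qed

section \<open>Elements of prescribed order\<close>

context group
begin

lemma ord_mult_commuting_coprime:
  assumes x: "x \<in> carrier G" and y: "y \<in> carrier G" and xy: "x \<otimes> y = y \<otimes> x"
    and cop: "coprime (ord x) (ord y)"
  shows "ord (x \<otimes> y) = ord x * ord y"
proof (rule dvd_antisym)
  show "ord (x \<otimes> y) dvd ord x * ord y"
    using xy x y by (rule ord_mul_divides)
  (* If (x y)^k = 1, raising to the order of y leaves x^(k * ord y) = 1; coprimality cancels ord y. *)
  let ?k = "ord (x \<otimes> y)"
  have pow: "x [^] (?k * n) \<otimes> y [^] (?k * n) = \<one>" for n
    using x y pow_eq_id[of "x \<otimes> y" "?k * n"] pow_mult_distrib[OF xy x y] by simp
  have "x [^] (?k * ord y) = \<one>"
    using pow[of "ord y"] x y pow_eq_id[of y "?k * ord y"] by simp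
  then have "ord x dvd ?k * ord y"
    using x pow_eq_id by blast
  then have "ord x dvd ?k"
    using cop by (simp add: coprime_dvd_mult_left_iff)
  have "y [^] (?k * ord x) = \<one>"
    using pow[of "ord x"] x y pow_eq_id[of x "?k * ord x"] by simp
  then have "ord y dvd ?k * ord x"
    using y pow_eq_id by blast
  then have "ord y dvd ?k"
    using cop by (simp add: coprime_dvd_mult_left_iff coprime_commute)
  with \<open>ord x dvd ?k\<close> show "ord x * ord y dvd ?k"
    using cop by (simp add: divides_mult)
qed

text \<open>
  Any nontrivial element of a Sylow \<open>p\<close>-subgroup has order $p^k$ with $k > 0$, and its power with
  exponent $p^{k-1}$ has order \<open>p\<close>.
\<close>

theorem Cauchy_ex_ord_prime:
  fixes p :: nat
  assumes fin: "finite (carrier G)" and p: "prime p" and dvd: "p dvd order G"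
  shows "\<exists>x\<in>carrier G. ord x = p"
proof -
  have "order G \<noteq> 0"
    using fin order_gt_0_iff_finite by simp
  then obtain a m where am: "order G = p ^ a * m" and "\<not> p dvd m"
    using p by (metis multiplicity_decompose' not_prime_unit)
  with dvd have "a \<noteq> 0"
    by (cases a) auto
  obtain H where H: "subgroup H G" "card H = p ^ a"
    using sylow_thm[OF p group_axioms am fin] by blast
  interpret H: group "G\<lparr>carrier := H\<rparr>"
    using H(1) by (rule subgroup_imp_group)
  have "card H > 1"
    using H(2) p \<open>a \<noteq> 0\<close> by (metis One_nat_def one_less_power neq0_conv prime_gt_1_nat)
  then have "\<not> H \<subseteq> {\<one>}"
    using card_mono[of "{\<one>}" H] by auto
  then obtain x where x: "x \<in> H" "x \<noteq> \<one>"
    by blast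
  then have xG: "x \<in> carrier G"
    using H(1) subgroup.subset by blast
  have "x [^] (p ^ a) = \<one>"
    using H.pow_order_eq_1[of x] x(1) H(2) by (simp add: order_def flip: nat_pow_consistent)
  then have "ord x dvd p ^ a"
    using xG pow_eq_id by blast
  then obtain k where k: "ord x = p ^ k"
    using p by (auto simp: divides_primepow_nat)
  moreover have "k \<noteq> 0"
    using k x(2) xG ord_eq_1 by (cases k) auto
  ultimately have "ord x = p ^ (k - 1) * p"
    by (metis power_minus_mult neq0_conv)
  then have "ord (x [^] (p ^ (k - 1))) = p"
    using ord_pow[OF xG, of "p ^ (k - 1)"] p by (simp add: prime_gt_0_nat)
  then show ?thesis
    using xG nat_pow_closed by blast
qed

end

section \<open>Induced paths in the co-prime graph\<close>

lemma coprime_graph_cograph_iff: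
  assumes "finite (carrier G)"
  shows "cograph (with_proj (coprime_graph G)) \<longleftrightarrow>
    \<not> (\<exists>a\<in>carrier G. \<exists>b\<in>carrier G. \<exists>c\<in>carrier G. \<exists>d\<in>carrier G. distinct [a, b, c, d] \<and>
         coprime (group.ord G a) (group.ord G b) \<and> coprime (group.ord G b) (group.ord G c) \<and>
         coprime (group.ord G c) (group.ord G d) \<and> \<not> coprime (group.ord G a) (group.ord G c) \<and>
         \<not> coprime (group.ord G b) (group.ord G d) \<and> \<not> coprime (group.ord G a) (group.ord G d))"
proof -
  have *: "(x, y) \<in> parcs (coprime_graph G) \<longleftrightarrow>
      x \<in> carrier G \<and> y \<in> carrier G \<and> x \<noteq> y \<and> coprime (group.ord G x) (group.ord G y)" for x y
    by (simp add: coprime_graph_def coprime_iff_gcd_eq_1)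
  have V: "pverts (coprime_graph G) = carrier G"
    by (simp add: coprime_graph_def)
  show ?thesis
    unfolding cograph_iff[OF pair_graph_coprime_graph[OF assms]] V *
    by (rule arg_cong[where f = Not]) (intro bex_cong refl; auto)
qed

text \<open>
  Here \<open>p\<close>, \<open>q\<close>, \<open>r\<close> divide both orders of the pairs \<open>a,c\<close> and \<open>b,d\<close> and \<open>a,d\<close>, respectively. The edges
  of the path separate them: \<open>a,b\<close> gives \<open>p \<noteq> q\<close> and \<open>r \<noteq> q\<close>, and \<open>c,d\<close> gives \<open>p \<noteq> r\<close>.
\<close>

lemma three_primes_of_coprime_path:
  fixes a b c d n :: nat
  assumes n: "n \<noteq> 0" and dvd: "a dvd n" "b dvd n" "d dvd n"
    and ab: "coprime a b" and bc: "coprime b c" and cd: "coprime c d"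
    and ac: "\<not> coprime a c" and bd: "\<not> coprime b d" and ad: "\<not> coprime a d"
  shows "3 \<le> card (prime_factors n)"
proof -
  have common: "\<exists>p. prime p \<and> p dvd u \<and> p dvd v" if "\<not> coprime u v" for u v :: nat
    using that prime_factor_nat[of "gcd u v"] by (auto simp: coprime_iff_gcd_eq_1)
  obtain p q r where p: "prime p" "p dvd a" "p dvd c" and q: "prime q" "q dvd b" "q dvd d"
    and r: "prime r" "r dvd a" "r dvd d"
    using common ac bd ad by meson
  have disj: "s \<noteq> t" if "coprime u v" "prime s" "s dvd u" "t dvd v" for s t u v :: nat
    using that coprime_common_divisor not_prime_unit by blast
  have "p \<noteq> q" "q \<noteq> r" "p \<noteq> r"
    using disj[OF ab p(1,2) q(2)] disj[OF ab r(1,2) q(2)] disj[OF cd p(1,3) r(3)] by auto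
  then have "card {p, q, r} = 3"
    by simp
  moreover have "{p, q, r} \<subseteq> prime_factors n"
    using p q r dvd n by (auto simp: in_prime_factors_iff intro: dvd_trans)
  ultimately show ?thesis
    by (metis card_mono finite_set_mset)
qed

theorem theorem6:
  fixes G :: "('a, 'b) monoid_scheme"
  assumes "nilpotent_group G" and "finite (carrier G)"
  shows "cograph (with_proj (coprime_graph G)) \<longleftrightarrow> card (prime_factors (order G)) < 3"
proof -
  interpret group G
    using assms(1) by (simp add: nilpotent_group_def)
  have n0: "order G \<noteq> 0"
    using assms(2) order_gt_0_iff_finite by simp
  show ?thesis
  proof
    assume cog: "cograph (with_proj (coprime_graph G))"
    show "card (prime_factors (order G)) < 3"
    proof (rule ccontr)
      assume "\<not> ?thesis"
      then obtain P where "P \<subseteq> prime_factors (order G)" "card P = 3"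
        by (meson not_less obtain_subset_with_card_n)
      then obtain p q r where "p \<noteq> q" "q \<noteq> r" "p \<noteq> r"
        and pqr: "{p, q, r} \<subseteq> prime_factors (order G)"
        by (auto simp: card_3_iff)
      then have prime: "prime p" "prime q" "prime r"
        and dvd: "p dvd order G" "q dvd order G" "r dvd order G"
        by auto
      have cop: "coprime p q" "coprime q r" "coprime p r"
        using prime \<open>p \<noteq> q\<close> \<open>q \<noteq> r\<close> \<open>p \<noteq> r\<close> by (auto intro: primes_coprime)
      obtain x y z where x: "x \<in> carrier G" "ord x = p" and y: "y \<in> carrier G" "ord y = q"
        and z: "z \<in> carrier G" "ord z = r"
        using Cauchy_ex_ord_prime[OF assms(2)] prime dvd by meson
      (* The path is y z, x, y, x z, with orders qr, p, q, pr. *)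
      have yz: "ord (y \<otimes>\<^bsub>G\<^esub> z) = q * r" and xz: "ord (x \<otimes>\<^bsub>G\<^esub> z) = p * r"
        using nilpotent_group_coprime_commute[OF assms(1)] ord_mult_commuting_coprime x y z cop
        by metis+
      have "p \<noteq> 1" "q \<noteq> 1" "r \<noteq> 1"
        using prime by auto
      then have ord: "coprime (ord (y \<otimes>\<^bsub>G\<^esub> z)) (ord x)" "coprime (ord x) (ord y)"
        "coprime (ord y) (ord (x \<otimes>\<^bsub>G\<^esub> z))" "\<not> coprime (ord (y \<otimes>\<^bsub>G\<^esub> z)) (ord y)"
        "\<not> coprime (ord x) (ord (x \<otimes>\<^bsub>G\<^esub> z))" "\<not> coprime (ord (y \<otimes>\<^bsub>G\<^esub> z)) (ord (x \<otimes>\<^bsub>G\<^esub> z))"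
        using cop by (simp_all add: x y yz xz coprime_commute)
      have "p \<noteq> q * r" "q \<noteq> q * r" "p * r \<noteq> q * r" "p \<noteq> p * r" "q \<noteq> p * r"
        using \<open>p \<noteq> q\<close> prime \<open>r \<noteq> 1\<close> \<open>p \<noteq> 1\<close> \<open>q \<noteq> 1\<close> cop by auto
      then have "distinct [y \<otimes>\<^bsub>G\<^esub> z, x, y, x \<otimes>\<^bsub>G\<^esub> z]"
        using x y yz xz \<open>p \<noteq> q\<close> by auto
      with ord show False
        using cog x(1) y(1) z(1) unfolding coprime_graph_cograph_iff[OF assms(2)]
        by (meson m_closed)
    qed
  next
    assume "card (prime_factors (order G)) < 3"
    then show "cograph (with_proj (coprime_graph G))"
      unfolding coprime_graph_cograph_iff[OF assms(2)]
      using three_primes_of_coprime_path[OF n0] ord_dvd_group_order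
      by (meson not_less)
  qed
qed

end
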